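(* Let $q, T_{\mathrm{ini}}, T_{\mathrm{f}} \in \mathbb{N}$, let $\mathcal{B} \subseteq (\mathbb{R}^q)^{\mathbb{N}}$ be a complete linear time-invariant system with lag $\ell$, and let $w_{\mathrm{ref}} \in \mathbb{R}^{qT_{\mathrm{f}}}$. Let $\Phi \in \mathbb{R}^{q\times q}$ be symmetric and positive definite, let $w_{\mathrm{ini}} \in \mathcal{B}|_{[1,T_{\mathrm{ini}}]}$ with $T_{\mathrm{ini}} \ge \ell$, and let $\alpha \in (0, 1/\rho(\Phi))$, where $\rho(\Phi)$ is the spectral radius of $\Phi$. Consider the optimization problem $$\min_{w \in \mathbb{R}^{q(T_{\mathrm{ini}}+T_{\mathrm{f}})}} \ g(w) + h(w),$$ where $$g(w) = \iota_{\mathcal{B}|_{[1,T_{\mathrm{ini}}+T_{\mathrm{f}}]}}(w) + \iota_{\{w_{\mathrm{ini}}\}}(\Pi_{\mathrm{ini}} w), \qquad h(w) = (\Pi_{\mathrm{f}} w - w_{\mathrm{ref}})^{\mathsf T} (I_{T_{\mathrm{f}}} \otimes \Phi)(\Pi_{\mathrm{f}} w - w_{\mathrm{ref}}).$$ Let $\mathcal{A} = \{ w \in \mathcal{B}|_{[1,T_{\mathrm{ini}}+T_{\mathrm{f}}]} : \Pi_{\mathrm{ini}} w = w_{\mathrm{ini}} \}$. For an arbitrary initial guess $w_1 \in \mathbb{R}^{q(T_{\mathrm{ini}}+T_{\mathrm{f}})}$, define the sequence $\{w_k\}_{k\in\mathbb{N}}$ by, for $k = 1, 2, \dots$, $$z_{k+1}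 = 2\,\Pi_{\mathrm{f}}^{\mathsf T} (I_{T_{\mathrm{f}}} \otimes \Phi)(\Pi_{\mathrm{f}} w_k - w_{\mathrm{ref}}), \qquad w_{k+1} = P_{\mathcal{A}}(w_k - \alpha z_{k+1}).$$ Then $\{w_k\}_{k\in\mathbb{N}}$ converges to the unique global optimum of the optimization problem.
   Context: $\mathbb{N}$ is the set of positive integers. A (discrete-time) system is identified with its behavior $\mathcal{B} \subseteq (\mathbb{R}^q)^{\mathbb{N}}$, a set of sequences $w:\mathbb{N}\to\mathbb{R}^q$. It is linear if it is a linear subspace, time-invariant if $\sigma(\mathcal{B}) \subseteq \mathcal{B}$ where $(\sigma w)(t) = w(t+1)$, and complete if it is closed in the topology of pointwise convergence. For $T \in \mathbb{N}$, $\mathcal{B}|_{[1,T]}$ is the set of restrictions of elements of $\mathcal{B}$ to $\{1,\dots,T\}$; a finite sequence $w \in (\mathbb{R}^q)^{\{1,\dots,T\}}$ is identified with the column vector $\mathrm{col}(w(1),\dots,w(T)) \in \mathbb{R}^{qT}$, so that $\mathcal{B}|_{[1,T]}$ is a subset of $\mathbb{R}^{qT}$. Every complete linear time-invariant system admits a kernel representation $\mathcal{B} = \{w \in (\mathbb{R}^q)^{\mathbb{N}} : R(\sigma) w = 0\}$ with $R(z) = R_0 + R_1 z + \dots + R_d z^d$ a real polynomial matrix with $q$ columns. The lag $\ell$ of $\mathcal{B}$ is the smallest possible degree (maximum row degree) of $R$ over all such kernel representations. $\Pi_{\mathrm{ini}} = [\, I_{qT_{\mathrm{ini}}} \ \ 0_{qT_{\mathrm{ini}}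 \times qT_{\mathrm{f}}} \,]$ and $\Pi_{\mathrm{f}} = [\, 0_{qT_{\mathrm{f}} \times qT_{\mathrm{ini}}} \ \ I_{qT_{\mathrm{f}}} \,]$ extract the first $qT_{\mathrm{ini}}$ and last $qT_{\mathrm{f}}$ entries of a vector in $\mathbb{R}^{q(T_{\mathrm{ini}}+T_{\mathrm{f}})}$. $\iota_C$ is the indicator function of a set $C$ (equal to $0$ on $C$ and $+\infty$ outside). $P_C$ is the Euclidean orthogonal projection onto a nonempty closed convex set $C$. $\otimes$ is the Kronecker product. *)

theory Defs
  imports
    "Jordan_Normal_Form.Spectral_Radius"
    "HOL-Analysis.Abstract_Metric_Spaces"
    "HOL-Analysis.Function_Topology"
    "HOL-Analysis.L2_Norm"
    "HOL-Library.Extended_Real"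
begin

text \<open>
  The dimension is an explicit parameter because \<^locale>\<open>Metric_space\<close> requires the distance
  to be symmetric on the whole type, including vectors of other dimensions.
\<close>

definition vdist :: "nat \<Rightarrow> real Matrix.vec \<Rightarrow> real Matrix.vec \<Rightarrow> real" where
  "vdist n u v = L2_set (\<lambda>i. vec_index u i - vec_index v i) {..<n}"

lemma Metric_space_vdist: "Metric_space (carrier_vec n) (vdist n)"
proof
  fix x y z :: "real Matrix.vec"
  show "0 \<le> vdist n x y"
    by (simp add: vdist_def)
  show "vdist n x y = vdist n y x"
    unfolding vdist_def L2_set_def by (simp add: power2_commute)
  assume x: "x \<in> carrier_vec n" and y: "y \<in> carrier_vec n"
  show "(vdist n x y = 0) = (x = y)"
    using x y unfolding vdist_def by (auto simp: L2_set_eq_0_iff intro!: eq_vecI)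
  have "vdist n x z = L2_set (\<lambda>i. (vec_index x i - vec_index y i) + (vec_index y i - vec_index z i)) {..<n}"
    unfolding vdist_def by simp
  also have "\<dots> \<le> vdist n x y + vdist n y z"
    unfolding vdist_def by (rule L2_set_triangle_ineq)
  finally show "vdist n x z \<le> vdist n x y + vdist n y z" .
qed

definition vtop :: "nat \<Rightarrow> real Matrix.vec topology" where
  "vtop n = Metric_space.mtopology (carrier_vec n) (vdist n)"

text \<open>Only meaningful when the minimizer is unique, e.g. for nonempty closed convex \<open>C\<close>.\<close>

definition proj :: "nat \<Rightarrow> real Matrix.vec set \<Rightarrow> real Matrix.vec \<Rightarrow> real Matrix.vec" where
  "proj n C x = arg_min_on (vdist n x) C"

definition indicator_fun :: "'a set \<Rightarrow> 'a \<Rightarrow> ereal" where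
  "indicator_fun C x = (if x \<in> C then 0 else \<infinity>)"

definition kron :: "real Matrix.mat \<Rightarrow> real Matrix.mat \<Rightarrow> real Matrix.mat" where
  "kron A B = Matrix.mat (dim_row A * dim_row B) (dim_col A * dim_col B)
     (\<lambda>(i, j). A $$ (i div dim_row B, j div dim_col B) * B $$ (i mod dim_row B, j mod dim_col B))"

text \<open>
  \<open>[I\<^sub>a 0]\<close> and \<open>[0 I\<^sub>b]\<close>, written as block matrices whose second block row is empty.
\<close>

definition Pi_first :: "nat \<Rightarrow> nat \<Rightarrow> real Matrix.mat" where
  "Pi_first a b = four_block_mat (1\<^sub>m a) (0\<^sub>m a b) (0\<^sub>m 0 a) (0\<^sub>m 0 b)"

definition Pi_last :: "nat \<Rightarrow> nat \<Rightarrow> real Matrix.mat" where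
  "Pi_last a b = four_block_mat (0\<^sub>m b a) (1\<^sub>m b) (0\<^sub>m 0 a) (0\<^sub>m 0 b)"

definition sym_pos_def :: "nat \<Rightarrow> real Matrix.mat \<Rightarrow> bool" where
  "sym_pos_def n M \<longleftrightarrow> M \<in> carrier_mat n n \<and> transpose_mat M = M \<and>
     (\<forall>x\<in>carrier_vec n. x \<noteq> 0\<^sub>v n \<longrightarrow> x \<bullet> (M *\<^sub>v x) > 0)"

text \<open>
  The time axis is the set \<open>{1..}\<close> of positive integers; a sequence is an extensional function on
  it, so its value at \<open>0\<close> is the dummy \<^term>\<open>undefined\<close>.
\<close>

type_synonym seq = "nat \<Rightarrow> real Matrix.vec"

definition seqs :: "nat \<Rightarrow> seq set" where
  "seqs q = {1..} \<rightarrow>\<^sub>E carrier_vec q"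

definition shift :: "seq \<Rightarrow> seq" where
  "shift w = (\<lambda>t\<in>{1..}. w (t + 1))"

definition linear_behavior :: "nat \<Rightarrow> seq set \<Rightarrow> bool" where
  "linear_behavior q B \<longleftrightarrow> B \<subseteq> seqs q \<and>
     (\<lambda>t\<in>{1..}. 0\<^sub>v q) \<in> B \<and>
     (\<forall>v\<in>B. \<forall>w\<in>B. (\<lambda>t\<in>{1..}. v t + w t) \<in> B) \<and>
     (\<forall>c. \<forall>w\<in>B. (\<lambda>t\<in>{1..}. c \<cdot>\<^sub>v w t) \<in> B)"

definition time_invariant :: "seq set \<Rightarrow> bool" where
  "time_invariant B \<longleftrightarrow> shift ` B \<subseteq> B"

definition complete_behavior :: "nat \<Rightarrow> seq set \<Rightarrow> bool" where
  "complete_behavior q B \<longleftrightarrow> closedin (product_topology (\<lambda>_. vtop q) {1..}) B"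

definition complete_lti :: "nat \<Rightarrow> seq set \<Rightarrow> bool" where
  "complete_lti q B \<longleftrightarrow> linear_behavior q B \<and> time_invariant B \<and> complete_behavior q B"

text \<open>\<open>col(w(1), \<dots>, w(T))\<close>: entry \<open>i = q * s + j\<close> with \<open>j < q\<close> is component \<open>j\<close> of \<open>w(s + 1)\<close>.\<close>

definition col_traj :: "nat \<Rightarrow> nat \<Rightarrow> seq \<Rightarrow> real Matrix.vec" where
  "col_traj q T w = Matrix.vec (q * T) (\<lambda>i. vec_index (w (i div q + 1)) (i mod q))"

definition restr_behavior :: "nat \<Rightarrow> nat \<Rightarrow> seq set \<Rightarrow> real Matrix.vec set" where
  "restr_behavior q T B = col_traj q T ` B"

text \<open>The zero matrix (and a matrix without rows) is given degree \<open>0\<close>.\<close>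

definition pmat_degree :: "real poly Matrix.mat \<Rightarrow> nat" where
  "pmat_degree R = Max (insert 0 ((\<lambda>ij. degree (R $$ ij)) ` ({..<dim_row R} \<times> {..<dim_col R})))"

definition pmat_coeff :: "real poly Matrix.mat \<Rightarrow> nat \<Rightarrow> real Matrix.mat" where
  "pmat_coeff R k = map_mat (\<lambda>p. poly.coeff p k) R"

text \<open>\<open>(R(\<sigma>) w)(t) = R\<^sub>0 w(t) + R\<^sub>1 w(t + 1) + \<dots> + R\<^sub>d w(t + d)\<close>\<close>

definition pmat_shift :: "real poly Matrix.mat \<Rightarrow> seq \<Rightarrow> seq" where
  "pmat_shift R w = (\<lambda>t\<in>{1..}. Matrix.vec (dim_row R)
     (\<lambda>i. \<Sum>k\<le>pmat_degree R. vec_index (pmat_coeff R k *\<^sub>v (shift ^^ k) w t) i))"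

definition kernel_rep :: "nat \<Rightarrow> real poly Matrix.mat \<Rightarrow> seq set \<Rightarrow> bool" where
  "kernel_rep q R B \<longleftrightarrow> dim_col R = q \<and>
     B = {w \<in> seqs q. pmat_shift R w = (\<lambda>t\<in>{1..}. 0\<^sub>v (dim_row R))}"

definition lag :: "nat \<Rightarrow> seq set \<Rightarrow> nat" where
  "lag q B = (LEAST d. \<exists>R. kernel_rep q R B \<and> pmat_degree R = d)"

end

theory Submission
  imports Defs
begin

text \<open>
  The feasible set \<open>A\<close> is an affine subspace: it contains the restriction of any trajectory of \<open>B\<close>
  that extends \<open>w_ini\<close>, and its direction \<open>V\<close> consists of the restricted trajectories with zero past.
  Completing the reference by a zero past to \<open>c = Pf\<^sup>T w_ref\<close> turns the cost into
  \<open>h x = (x - c) \<bullet> M (x - c)\<close> with \<open>M = Pf\<^sup>T W Pf\<close>. This form is only semidefinite on the whole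
  space, but on \<open>V\<close> all the mass of a vector lies in its last entries, where \<open>W\<close> is positive
  definite; so \<open>M\<close> is bounded below on \<open>V\<close> by a multiple of the squared norm.

  The optimum exists because it is the projection of \<open>c\<close> to \<open>A\<close> that is orthogonal for the form \<open>M\<close>
  (\<open>ex_orthogonal_projection\<close>). It is characterized by \<open>M (y - c) \<bottom> V\<close>, hence it is unique and it
  is a fixed point of the iteration.

  For convergence, the Euclidean projection to \<open>A\<close> is nonexpansive, so it suffices that the gradient
  step contracts the error \<open>d \<in> V\<close>. Expanding,
  \<open>|d - 2 \<alpha> M d|\<^sup>2 = |d|\<^sup>2 - 4 \<alpha> (d \<bullet> M d) + 4 \<alpha>\<^sup>2 |M d|\<^sup>2\<close>, and if \<open>l\<close> bounds the form of \<open>M\<close> then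
  \<open>|M d|\<^sup>2 \<le> l (d \<bullet> M d)\<close> (\<open>psd_norm_mult_le\<close>, by the Cauchy-Schwarz inequality for the semidefinite
  form). The right-hand side is therefore at most \<open>|d|\<^sup>2 - 4 \<alpha> (1 - \<alpha> l) (d \<bullet> M d)\<close>, which is a fixed
  fraction of \<open>|d|\<^sup>2\<close> as soon as \<open>\<alpha> l < 1\<close>. One may take \<open>l\<close> to be the spectral radius of \<open>\<Phi>\<close>: the
  maximum of the Rayleigh quotient is an eigenvalue (\<open>quad_form_le_spectral_radius\<close>), and the
  form of \<open>I \<otimes> \<Phi>\<close> is a sum of copies of the form of \<open>\<Phi>\<close> (\<open>kron_one_quad_form\<close>). As the
  gradient is \<open>2 M (x - c)\<close>, the bound \<open>\<alpha> < 1 / l\<close> is exactly what keeps the factor \<open>1 - 2 \<alpha> \<lambda>\<close>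
  strictly between \<open>-1\<close> and \<open>1\<close> for every eigenvalue \<open>\<lambda>\<close> of \<open>\<Phi>\<close>.
\<close>

(* Leaves the scalar product and the indexing operator of the matrix library as the only
   readings of their infix symbols. *)
unbundle no inner_syntax and no vec_syntax

section \<open>Quadratic forms of symmetric matrices\<close>

definition lin_subspace :: "nat \<Rightarrow> real Matrix.vec set \<Rightarrow> bool" where
  "lin_subspace n V \<longleftrightarrow> V \<subseteq> carrier_vec n \<and> 0\<^sub>v n \<in> V \<and>
     (\<forall>u\<in>V. \<forall>v\<in>V. \<forall>c. u + c \<cdot>\<^sub>v v \<in> V)"

lemma lin_subspaceD:
  assumes "lin_subspace n V"
  shows "v \<in> V \<Longrightarrow> v \<in> carrier_vec n" "0\<^sub>v n \<in> V"
    and "u \<in> V \<Longrightarrow> v \<in> V \<Longrightarrow> u + c \<cdot>\<^sub>v v \<in> V"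
    and "u \<in> V \<Longrightarrow> v \<in> V \<Longrightarrow> u - v \<in> V"
proof -
  show *: "v \<in> V \<Longrightarrow> v \<in> carrier_vec n" "0\<^sub>v n \<in> V"
    "u \<in> V \<Longrightarrow> v \<in> V \<Longrightarrow> u + c \<cdot>\<^sub>v v \<in> V" for u v c
    using assms by (auto simp: lin_subspace_def)
  assume "u \<in> V" "v \<in> V"
  moreover from this have "u - v = u + (-1) \<cdot>\<^sub>v v"
    using *(1) by (intro eq_vecI) (auto dest!: *(1))
  ultimately show "u - v \<in> V" using *(3) by metis
qed

lemma eq_if_minus_eq_zero_vec:
  fixes x y :: "real Matrix.vec"
  assumes "x \<in> carrier_vec n" "y \<in> carrier_vec n" "x - y = 0\<^sub>v n"
  shows "x = y"
proof (rule eq_vecI)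
  show "x $ i = y $ i" if "i < dim_vec y" for i
    using arg_cong[OF assms(3), of "\<lambda>v. v $ i"] that assms(1,2) by simp
qed (use assms in auto)

lemma scalar_prod_mult_mat_vec_swap:
  fixes M :: "real Matrix.mat"
  assumes "M \<in> carrier_mat n n" "transpose_mat M = M" "x \<in> carrier_vec n" "y \<in> carrier_vec n"
  shows "x \<bullet> (M *\<^sub>v y) = y \<bullet> (M *\<^sub>v x)"
  using transpose_vec_mult_scalar[of M n n y x] assms
  by (simp add: comm_scalar_prod[of "M *\<^sub>v x" n y])

lemma mult_mat_vec_linear:
  fixes M :: "real Matrix.mat"
  assumes "M \<in> carrier_mat m n" "x \<in> carrier_vec n" "y \<in> carrier_vec n"
  shows "M *\<^sub>v (x + y) = M *\<^sub>v x + M *\<^sub>v y" "M *\<^sub>v (x - y) = M *\<^sub>v x - M *\<^sub>v y"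
    "M *\<^sub>v (c \<cdot>\<^sub>v x) = c \<cdot>\<^sub>v (M *\<^sub>v x)"
  using assms by (simp_all add: mult_add_distrib_mat_vec mult_minus_distrib_mat_vec mult_mat_vec)

lemmas scalar_prod_linear =
  add_scalar_prod_distrib[where n = n] scalar_prod_add_distrib[where n = n]
  minus_scalar_prod_distrib[where n = n] scalar_prod_minus_distrib[where n = n]
  smult_scalar_prod_distrib[where n = n] scalar_prod_smult_distrib[where n = n] for n

lemma scalar_prod_self:
  fixes x :: "real Matrix.vec"
  assumes "x \<in> carrier_vec n"
  shows "x \<bullet> x = (\<Sum>i<n. (x $ i)\<^sup>2)" "x \<bullet> x \<ge> 0" "x \<bullet> x = 0 \<longleftrightarrow> x = 0\<^sub>v n"
proof -
  show 1: "x \<bullet> x = (\<Sum>i<n. (x $ i)\<^sup>2)"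
    using assms by (simp add: scalar_prod_def power2_eq_square atLeast0LessThan)
  show "x \<bullet> x \<ge> 0" unfolding 1 by (simp add: sum_nonneg)
  show "x \<bullet> x = 0 \<longleftrightarrow> x = 0\<^sub>v n"
    unfolding 1 using assms by (auto simp: sum_nonneg_eq_0_iff)
qed

lemma quad_form_add_smult:
  fixes M :: "real Matrix.mat"
  assumes M: "M \<in> carrier_mat n n" "transpose_mat M = M"
    and x: "x \<in> carrier_vec n" and y: "y \<in> carrier_vec n"
  shows "(x + c \<cdot>\<^sub>v y) \<bullet> (M *\<^sub>v (x + c \<cdot>\<^sub>v y))
    = x \<bullet> (M *\<^sub>v x) + 2 * c * (y \<bullet> (M *\<^sub>v x)) + c\<^sup>2 * (y \<bullet> (M *\<^sub>v y))"
  using assms scalar_prod_mult_mat_vec_swap[OF M x y]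
  by (simp add: mult_mat_vec_linear[OF M(1)] scalar_prod_linear[of _ n] power2_eq_square algebra_simps)

text \<open>
  The form of \<open>M\<close> along the line \<open>x + c y\<close> is a nonnegative quadratic polynomial in \<open>c\<close>; its value at
  the vertex gives the inequality. As \<open>M\<close> is only semidefinite, the leading coefficient may vanish,
  and then so must the linear one.
\<close>

lemma psd_cauchy_schwarz:
  fixes M :: "real Matrix.mat"
  assumes M: "M \<in> carrier_mat n n" "transpose_mat M = M"
    and psd: "\<And>x. x \<in> carrier_vec n \<Longrightarrow> x \<bullet> (M *\<^sub>v x) \<ge> 0"
    and x: "x \<in> carrier_vec n" and y: "y \<in> carrier_vec n"
  shows "(x \<bullet> (M *\<^sub>v y))\<^sup>2 \<le> (x \<bullet> (M *\<^sub>v x)) * (y \<bullet> (M *\<^sub>v y))"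
proof -
  define a b d where "a = x \<bullet> (M *\<^sub>v x)" and "b = x \<bullet> (M *\<^sub>v y)" and "d = y \<bullet> (M *\<^sub>v y)"
  have b': "y \<bullet> (M *\<^sub>v x) = b"
    unfolding b_def by (rule scalar_prod_mult_mat_vec_swap[OF M y x])
  have q: "a + 2 * c * b + c\<^sup>2 * d \<ge> 0" for c
    using psd[of "x + c \<cdot>\<^sub>v y"] quad_form_add_smult[OF M x y, of c] x y
    by (simp add: a_def b' d_def)
  have d0: "d \<ge> 0" unfolding d_def by (rule psd[OF y])
  have "b\<^sup>2 \<le> a * d"
  proof (cases "d = 0")
    case True
    have "b = 0"
    proof (rule ccontr)
      assume "b \<noteq> 0"
      \<comment> \<open>At this \<open>c\<close> the polynomial, now affine, takes the value \<open>-1\<close>.\<close>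
      then show False using q[of "- (a + 1) / (2 * b)"] True by (simp add: field_simps)
    qed
    then show ?thesis using True by simp
  next
    case False
    then show ?thesis using q[of "- b / d"] d0 by (simp add: field_simps power2_eq_square)
  qed
  then show ?thesis by (simp add: a_def b_def d_def)
qed

lemma cauchy_schwarz_vec:
  fixes x y :: "real Matrix.vec"
  assumes "x \<in> carrier_vec n" "y \<in> carrier_vec n"
  shows "(x \<bullet> y)\<^sup>2 \<le> (x \<bullet> x) * (y \<bullet> y)"
  using psd_cauchy_schwarz[of "1\<^sub>m n" n x y] assms scalar_prod_self(2) by auto

text \<open>
  This is the operator inequality \<open>M\<^sup>2 \<le> l M\<close>, also known as cocoercivity of the gradient. It follows,
  without diagonalizing \<open>M\<close>, from Cauchy-Schwarz for the form of \<open>M\<close> applied to \<open>x\<close> and \<open>M x\<close>.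
\<close>

lemma psd_norm_mult_le:
  fixes M :: "real Matrix.mat"
  assumes M: "M \<in> carrier_mat n n" "transpose_mat M = M"
    and psd: "\<And>x. x \<in> carrier_vec n \<Longrightarrow> x \<bullet> (M *\<^sub>v x) \<ge> 0"
    and le: "\<And>x. x \<in> carrier_vec n \<Longrightarrow> x \<bullet> (M *\<^sub>v x) \<le> l * (x \<bullet> x)"
    and l: "l \<ge> 0" and x: "x \<in> carrier_vec n"
  shows "(M *\<^sub>v x) \<bullet> (M *\<^sub>v x) \<le> l * (x \<bullet> (M *\<^sub>v x))"
proof -
  define s where "s = (M *\<^sub>v x) \<bullet> (M *\<^sub>v x)"
  have Mx: "M *\<^sub>v x \<in> carrier_vec n" using M x by simp
  have "s\<^sup>2 \<le> (x \<bullet> (M *\<^sub>v x)) * ((M *\<^sub>v x) \<bullet> (M *\<^sub>v (M *\<^sub>v x)))"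
    using psd_cauchy_schwarz[OF M psd x Mx] scalar_prod_mult_mat_vec_swap[OF M x Mx]
    by (simp add: s_def)
  also have "\<dots> \<le> (x \<bullet> (M *\<^sub>v x)) * (l * s)"
    unfolding s_def by (intro mult_left_mono le Mx psd x)
  finally have "s * s \<le> (l * (x \<bullet> (M *\<^sub>v x))) * s" by (simp add: power2_eq_square algebra_simps)
  moreover have "s \<ge> 0" "l * (x \<bullet> (M *\<^sub>v x)) \<ge> 0"
    unfolding s_def using scalar_prod_self(2)[OF Mx] psd[OF x] l by auto
  ultimately show ?thesis unfolding s_def[symmetric]
    by (cases "s = 0") (auto simp: mult_le_cancel_right)
qed

text \<open>
  With \<open>M = 1\<close> this is Euclidean projection; with the Hessian of the cost it produces the optimum.
  Definiteness is asked on \<open>V\<close> because that Hessian is singular on the whole space.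

  The proof is Gram-Schmidt, organized as an induction on the number \<open>k\<close> of leading coordinates
  outside of which \<open>V\<close> vanishes: the vectors of \<open>V\<close> with vanishing coordinate \<open>k\<close> form a subspace
  \<open>V0\<close> of codimension at most one, and \<open>V\<close> is spanned by \<open>V0\<close> and one vector \<open>u\<close> orthogonal to it.
\<close>

lemma ex_orthogonal_projection:
  fixes M :: "real Matrix.mat"
  assumes M: "M \<in> carrier_mat n n" "transpose_mat M = M"
    and "lin_subspace n V"
    and "\<And>v. v \<in> V \<Longrightarrow> v \<noteq> 0\<^sub>v n \<Longrightarrow> v \<bullet> (M *\<^sub>v v) > 0"
    and x: "x \<in> carrier_vec n"
  shows "\<exists>p\<in>V. \<forall>v\<in>V. v \<bullet> (M *\<^sub>v (x - p)) = 0"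
proof -
  have "\<exists>p\<in>V. \<forall>v\<in>V. v \<bullet> (M *\<^sub>v (x - p)) = 0"
    if "x \<in> carrier_vec n" "lin_subspace n V"
      "\<And>v. v \<in> V \<Longrightarrow> v \<noteq> 0\<^sub>v n \<Longrightarrow> v \<bullet> (M *\<^sub>v v) > 0"
      "\<And>v i. v \<in> V \<Longrightarrow> k \<le> i \<Longrightarrow> i < n \<Longrightarrow> v $ i = 0" for k x V
    using that
  proof (induction k arbitrary: x V)
    case 0
    have "v = 0\<^sub>v n" if "v \<in> V" for v
      using 0(4)[OF that] lin_subspaceD(1)[OF 0(2) that] by (intro eq_vecI) auto
    then have "V = {0\<^sub>v n}" using lin_subspaceD(2)[OF 0(2)] by blast
    then show ?case using 0(1) M(1) by simp
  next
    case (Suc k)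
    note V = lin_subspaceD[OF Suc.prems(2)]
    define V0 where "V0 = {v \<in> V. k < n \<longrightarrow> v $ k = 0}"
    have V0: "lin_subspace n V0"
      unfolding lin_subspace_def
    proof (intro conjI ballI allI)
      fix u v :: "real Matrix.vec" and c :: real
      assume uv: "u \<in> V0" "v \<in> V0"
      then have "u \<in> V" "v \<in> V" by (auto simp: V0_def)
      from V(3)[OF this] V(1)[OF this(1)] V(1)[OF this(2)] uv
      show "u + c \<cdot>\<^sub>v v \<in> V0" by (simp add: V0_def)
    qed (use V(1,2) in \<open>auto simp: V0_def\<close>)
    have V0': "v $ i = 0" if "v \<in> V0" "k \<le> i" "i < n" for v i
      using that Suc.prems(4)[of v i] by (cases "i = k") (auto simp: V0_def)
    have IH: "\<exists>p\<in>V0. \<forall>v\<in>V0. v \<bullet> (M *\<^sub>v (y - p)) = 0" if "y \<in> carrier_vec n" for y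
      by (rule Suc.IH[OF that V0 _ V0']) (auto simp: V0_def intro: Suc.prems(3))
    show ?case
    proof (cases "V0 = V")
      case True
      then show ?thesis using IH[OF Suc.prems(1)] by simp
    next
      case False
      then obtain u0 where u0: "u0 \<in> V" "k < n" "u0 $ k \<noteq> 0" by (auto simp: V0_def)
      obtain r where r: "r \<in> V0" "\<And>v. v \<in> V0 \<Longrightarrow> v \<bullet> (M *\<^sub>v (u0 - r)) = 0"
        using IH[OF V(1)[OF u0(1)]] by blast
      define u where "u = u0 - r"
      have rV: "r \<in> V" and "r $ k = 0" using r(1) u0 by (auto simp: V0_def)
      have u: "u \<in> V" "u $ k \<noteq> 0"
        using u0 V(4)[OF u0(1) rV] \<open>r $ k = 0\<close> V(1)[OF rV] by (auto simp: u_def)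
      have uc: "u \<in> carrier_vec n" using V(1)[OF u(1)] .
      have orth: "v \<bullet> (M *\<^sub>v u) = 0" if "v \<in> V0" for v using r(2)[OF that] by (simp add: u_def)
      have "u \<noteq> 0\<^sub>v n" using u u0 by auto
      then have upos: "u \<bullet> (M *\<^sub>v u) > 0" using Suc.prems(3) u by blast
      obtain s where s: "s \<in> V0" "\<And>v. v \<in> V0 \<Longrightarrow> v \<bullet> (M *\<^sub>v (x - s)) = 0"
        using IH[OF Suc.prems(1)] by blast
      have sV: "s \<in> V" using s by (simp add: V0_def)
      have sc: "s \<in> carrier_vec n" using V(1)[OF sV] .
      define c where "c = (u \<bullet> (M *\<^sub>v (x - s))) / (u \<bullet> (M *\<^sub>v u))"
      define p where "p = s + c \<cdot>\<^sub>v u"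
          have xp: "x - p = (x - s) - c \<cdot>\<^sub>v u"
        using Suc.prems(1) sc uc by (intro eq_vecI) (auto simp: p_def)
      have split: "v \<bullet> (M *\<^sub>v (x - p)) = v \<bullet> (M *\<^sub>v (x - s)) - c * (v \<bullet> (M *\<^sub>v u))"
        if "v \<in> carrier_vec n" for v
        unfolding xp using that Suc.prems(1) sc uc M
        by (subst mult_mat_vec_linear(2)[OF M(1)])
          (auto simp: mult_mat_vec_linear(3)[OF M(1)] scalar_prod_linear[of _ n])
      have "v \<bullet> (M *\<^sub>v (x - p)) = 0" if v: "v \<in> V" for v
      proof -
        have vc: "v \<in> carrier_vec n" using V(1)[OF v] .
        \<comment> \<open>Coordinate \<open>k\<close> of \<open>v - t u\<close> vanishes, so \<open>v\<close> splits along \<open>V0\<close> and \<open>u\<close>.\<close>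
        define t where "t = v $ k / u $ k"
        define v0 where "v0 = v + (- t) \<cdot>\<^sub>v u"
        have "v0 \<in> V0" using V(3)[OF v u(1), of "-t"] u(2) vc uc
          by (auto simp: V0_def v0_def t_def)
        then have "v0 \<bullet> (M *\<^sub>v (x - p)) = 0"
          using split[of v0] orth[of v0] s(2)[of v0] V(1)[of v0] by (simp add: V0_def)
        moreover have "u \<bullet> (M *\<^sub>v (x - p)) = 0"
          using split[OF uc] upos by (simp add: c_def)
        moreover have "v0 \<bullet> (M *\<^sub>v (x - p)) = v \<bullet> (M *\<^sub>v (x - p)) - t * (u \<bullet> (M *\<^sub>v (x - p)))"
          unfolding v0_def using vc uc M Suc.prems(1) sc
          by (subst scalar_prod_linear(1)[of _ n]) (auto simp: p_def scalar_prod_linear(5)[of _ n])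
        ultimately show ?thesis by simp
      qed
      moreover have "p \<in> V" unfolding p_def by (rule V(3)[OF sV u(1)])
      ultimately show ?thesis by blast
    qed
  qed
  from this[of x V n] assms show ?thesis by simp
qed

section \<open>Rayleigh quotients and the spectral radius\<close>

text \<open>
  Compactness of the unit sphere. The sphere is represented in the function space
  \<^typ>\<open>nat \<Rightarrow> real\<close> with the product topology, as a closed subset of a product of compact intervals.
\<close>

lemma ex_max_rayleigh:
  fixes M :: "real Matrix.mat"
  assumes M: "M \<in> carrier_mat n n" and n: "n \<ge> 1"
  shows "\<exists>x\<in>carrier_vec n. x \<bullet> x = 1 \<and>
    (\<forall>y\<in>carrier_vec n. y \<bullet> (M *\<^sub>v y) \<le> (x \<bullet> (M *\<^sub>v x)) * (y \<bullet> y))"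
proof -
  \<comment> \<open>Coordinates beyond \<open>n\<close> are pinned to \<open>0\<close>, so that every factor is compact.\<close>
  define box where "box = (PiE UNIV (\<lambda>i. if i < n then {-1..1} else {0}) :: (nat \<Rightarrow> real) set)"
  define K where "K = box \<inter> {f. (\<Sum>i<n. (f i)\<^sup>2) = 1}"
  define F where "F = (\<lambda>f :: nat \<Rightarrow> real. \<Sum>i<n. f i * (\<Sum>j<n. M $$ (i, j) * f j))"
  have "compactin (product_topology (\<lambda>i. euclidean) UNIV) box"
    unfolding box_def compactin_PiE by (auto simp: compactin_euclidean_iff)
  then have "compact box" by (simp add: euclidean_product_topology compactin_euclidean_iff)
  moreover have "closed {f :: nat \<Rightarrow> real. (\<Sum>i<n. (f i)\<^sup>2) = 1}"
    by (intro closed_Collect_eq continuous_intros continuous_on_product_coordinates)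
  ultimately have "compact K" unfolding K_def by (rule compact_Int_closed)
  moreover have "continuous_on K F"
    unfolding F_def
    by (intro continuous_intros continuous_on_subset[OF continuous_on_product_coordinates]) auto
  moreover have "(\<lambda>i. if i = 0 then 1 else 0) \<in> K"
    using n by (auto simp: K_def box_def if_distrib[of "\<lambda>x. x\<^sup>2"] sum.delta cong: if_cong)
  ultimately obtain f where f: "f \<in> K" "\<And>h. h \<in> K \<Longrightarrow> F h \<le> F f"
    using continuous_attains_sup[of K F] by auto
  have F: "Matrix.vec n h \<bullet> (M *\<^sub>v Matrix.vec n h) = F h" for h
    unfolding F_def scalar_prod_def using M
    by (intro sum.cong) (auto simp: scalar_prod_def atLeast0LessThan intro!: sum.cong)
  have "Matrix.vec n f \<bullet> Matrix.vec n f = 1"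
    using f(1) by (simp add: scalar_prod_self(1)[of _ n] K_def)
  moreover have "y \<bullet> (M *\<^sub>v y) \<le> F f * (y \<bullet> y)" if y: "y \<in> carrier_vec n" for y
  proof (cases "y = 0\<^sub>v n")
    case True
    then show ?thesis using M by simp
  next
    case False
    then have pos: "y \<bullet> y > 0" using scalar_prod_self[OF y] by linarith
    define c where "c = 1 / sqrt (y \<bullet> y)"
    have c2: "c\<^sup>2 * (y \<bullet> y) = 1" using pos by (simp add: c_def power_divide)
    define h where "h = (\<lambda>i. if i < n then c * y $ i else 0)"
    have hv: "Matrix.vec n h = c \<cdot>\<^sub>v y" using y by (intro eq_vecI) (auto simp: h_def)
    have "(\<Sum>i<n. (h i)\<^sup>2) = 1"
      using c2 by (simp add: h_def power_mult_distrib scalar_prod_self(1)[OF y] sum_distrib_left)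
    moreover from this have "(h i)\<^sup>2 \<le> 1" if "i < n" for i
      using member_le_sum[of i "{..<n}" "\<lambda>i. (h i)\<^sup>2"] that by simp
    then have "\<bar>h i\<bar> \<le> 1" if "i < n" for i
      using that abs_square_le_1[of "h i"] by auto
    then have "h \<in> box" by (fastforce simp: box_def h_def abs_le_iff)
    ultimately have "F h \<le> F f" using f(2) by (simp add: K_def)
    moreover have "F h = c\<^sup>2 * (y \<bullet> (M *\<^sub>v y))"
      unfolding F[symmetric] hv using y M
      by (simp add: mult_mat_vec_linear[OF M] scalar_prod_linear[of _ n] power2_eq_square)
    ultimately have "c\<^sup>2 * (y \<bullet> (M *\<^sub>v y)) * (y \<bullet> y) \<le> F f * (y \<bullet> y)"
      using pos by (intro mult_right_mono) auto
    moreover have "c\<^sup>2 * (y \<bullet> (M *\<^sub>v y)) * (y \<bullet> y) = y \<bullet> (M *\<^sub>v y)"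
      using c2 by (metis mult.commute mult.assoc mult.right_neutral)
    ultimately show ?thesis by simp
  qed
  ultimately show ?thesis by (intro bexI[of _ "Matrix.vec n f"]) (auto simp: F)
qed

text \<open>
  If \<open>u\<close> maximizes the Rayleigh quotient, with maximum \<open>l\<close>, then \<open>N = l I - M\<close> is semidefinite and its
  form vanishes at \<open>u\<close>. By Cauchy-Schwarz \<open>u\<close> lies in the kernel of \<open>N\<close>, so \<open>l\<close> is an eigenvalue.
\<close>

lemma quad_form_le_spectral_radius:
  fixes M :: "real Matrix.mat"
  assumes M: "M \<in> carrier_mat n n" "transpose_mat M = M" and n: "n \<ge> 1"
    and x: "x \<in> carrier_vec n"
  shows "x \<bullet> (M *\<^sub>v x) \<le> spectral_radius (map_mat complex_of_real M) * (x \<bullet> x)"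
proof -
  obtain u where u: "u \<in> carrier_vec n" "u \<bullet> u = 1"
    and max: "\<And>y. y \<in> carrier_vec n \<Longrightarrow> y \<bullet> (M *\<^sub>v y) \<le> (u \<bullet> (M *\<^sub>v u)) * (y \<bullet> y)"
    using ex_max_rayleigh[OF M(1) n] by blast
  define l where "l = u \<bullet> (M *\<^sub>v u)"
  define N where "N = l \<cdot>\<^sub>m 1\<^sub>m n - M"
  have "M $$ (j, i) = M $$ (i, j)" if "i < n" "j < n" for i j
    using arg_cong[OF M(2), of "\<lambda>A. A $$ (i, j)"] that M(1) by simp
  then have N: "N \<in> carrier_mat n n" "transpose_mat N = N"
    using M(1) by (auto simp: N_def intro!: eq_matI)
  have Nv: "N *\<^sub>v y = l \<cdot>\<^sub>v y - M *\<^sub>v y" if "y \<in> carrier_vec n" for y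
  proof -
    have "(l \<cdot>\<^sub>m 1\<^sub>m n) *\<^sub>v y = l \<cdot>\<^sub>v y"
      using that by (intro eq_vecI) auto
    then show ?thesis using that M by (simp add: N_def minus_mult_distrib_mat_vec[of _ n n])
  qed
  have psd: "y \<bullet> (N *\<^sub>v y) \<ge> 0" if "y \<in> carrier_vec n" for y
    using max[OF that] that M by (simp add: Nv l_def scalar_prod_linear[of _ n])
  have "u \<bullet> (N *\<^sub>v u) = 0"
    using u M by (simp add: Nv l_def scalar_prod_linear[of _ n])
  moreover have Nu: "N *\<^sub>v u \<in> carrier_vec n" using N u by simp
  ultimately have "(N *\<^sub>v u) \<bullet> (N *\<^sub>v u) = 0"
    using psd_cauchy_schwarz[OF N psd Nu u(1)] by simp
  then have "N *\<^sub>v u = 0\<^sub>v n" using scalar_prod_self(3)[OF Nu] by simp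
  then have "l \<cdot>\<^sub>v u - M *\<^sub>v u = 0\<^sub>v n" using Nv[OF u(1)] by simp
  then have "M *\<^sub>v u = l \<cdot>\<^sub>v u"
    using u M eq_if_minus_eq_zero_vec[of "l \<cdot>\<^sub>v u" n "M *\<^sub>v u"] by simp
  moreover have "u \<noteq> 0\<^sub>v n" using u by auto
  ultimately have "eigenvalue M l" using u M by (auto simp: eigenvalue_def eigenvector_def)
  then have "eigenvalue (map_mat complex_of_real M) (complex_of_real l)"
    by (rule of_real_hom.eigenvalue_hom[OF M(1)])
  then have "norm (complex_of_real l) \<in> norm ` spectrum (map_mat complex_of_real M)"
    unfolding spectrum_def by blast
  then have "norm (complex_of_real l) \<le> spectral_radius (map_mat complex_of_real M)"
    using M n by (intro spectral_radius_mem_max(2)[of _ n]) auto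
  then have "l \<le> spectral_radius (map_mat complex_of_real M)" by simp
  then show ?thesis
    using max[OF x] mult_right_mono[OF _ scalar_prod_self(2)[OF x]] unfolding l_def by fastforce
qed

text \<open>The constant is the maximal Rayleigh quotient of \<open>- M\<close>, with the opposite sign.\<close>

lemma pos_def_quad_form_lower_bound:
  fixes M :: "real Matrix.mat"
  assumes M: "M \<in> carrier_mat n n" and n: "n \<ge> 1"
    and pos: "\<And>x. x \<in> carrier_vec n \<Longrightarrow> x \<noteq> 0\<^sub>v n \<Longrightarrow> x \<bullet> (M *\<^sub>v x) > 0"
  shows "\<exists>m>0. \<forall>x\<in>carrier_vec n. m * (x \<bullet> x) \<le> x \<bullet> (M *\<^sub>v x)"
proof -
  have neg: "y \<bullet> ((- M) *\<^sub>v y) = - (y \<bullet> (M *\<^sub>v y))" if "y \<in> carrier_vec n" for y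
    using that M by (simp add: uminus_mult_mat_vec)
  have "- M \<in> carrier_mat n n" using M by simp
  from ex_max_rayleigh[OF this n]
  obtain u where u: "u \<in> carrier_vec n" "u \<bullet> u = 1"
    and "\<And>y. y \<in> carrier_vec n \<Longrightarrow> y \<bullet> ((- M) *\<^sub>v y) \<le> (u \<bullet> ((- M) *\<^sub>v u)) * (y \<bullet> y)" by blast
  then have "\<forall>y\<in>carrier_vec n. (u \<bullet> (M *\<^sub>v u)) * (y \<bullet> y) \<le> y \<bullet> (M *\<^sub>v y)"
    by (simp add: neg)
  moreover have "u \<noteq> 0\<^sub>v n" using u by auto
  ultimately show ?thesis using pos[OF u(1)] by blast
qed

section \<open>Projected gradient descent on an affine subspace\<close>

lemma gradient_step_contracts:
  fixes M :: "real Matrix.mat"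
  assumes M: "M \<in> carrier_mat n n" "transpose_mat M = M"
    and psd: "\<And>x. x \<in> carrier_vec n \<Longrightarrow> x \<bullet> (M *\<^sub>v x) \<ge> 0"
    and le: "\<And>x. x \<in> carrier_vec n \<Longrightarrow> x \<bullet> (M *\<^sub>v x) \<le> l * (x \<bullet> x)"
    and l: "l \<ge> 0" and a: "a > 0" "a * l < 1"
    and d: "d \<in> carrier_vec n" and m: "m * (d \<bullet> d) \<le> d \<bullet> (M *\<^sub>v d)"
  defines "u \<equiv> d - a \<cdot>\<^sub>v (2 \<cdot>\<^sub>v (M *\<^sub>v d))"
  shows "u \<bullet> u \<le> (1 - 4 * a * (1 - a * l) * m) * (d \<bullet> d)"
proof -
  have Md: "M *\<^sub>v d \<in> carrier_vec n" using M d by simp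
  have "u \<bullet> u = d \<bullet> d - 4 * a * (d \<bullet> (M *\<^sub>v d)) + 4 * a * (a * ((M *\<^sub>v d) \<bullet> (M *\<^sub>v d)))"
    unfolding u_def using d Md comm_scalar_prod[OF d Md]
    by (simp add: scalar_prod_linear[of _ n] algebra_simps)
  also have "\<dots> \<le> d \<bullet> d - 4 * a * (d \<bullet> (M *\<^sub>v d)) + 4 * a * (a * (l * (d \<bullet> (M *\<^sub>v d))))"
    using psd_norm_mult_le[OF M psd le l d] a by (intro add_left_mono mult_left_mono) auto
  also have "\<dots> = d \<bullet> d - 4 * a * (1 - a * l) * (d \<bullet> (M *\<^sub>v d))" by (simp add: algebra_simps)
  also have "\<dots> \<le> d \<bullet> d - 4 * a * (1 - a * l) * (m * (d \<bullet> d))"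
    using a m by (intro diff_left_mono mult_left_mono) auto
  finally show ?thesis by (simp add: algebra_simps)
qed

lemma vdist_power2:
  assumes "x \<in> carrier_vec n" "y \<in> carrier_vec n"
  shows "(vdist n x y)\<^sup>2 = (x - y) \<bullet> (x - y)"
  using assms by (simp add: vdist_def L2_set_def sum_nonneg scalar_prod_self(1)[of _ n])

lemma vdist_nonneg: "vdist n x y \<ge> 0"
  by (simp add: vdist_def)

text \<open>
  By Pythagoras, a point of \<open>A\<close> with orthogonal residual is strictly nearer to \<open>x\<close> than any other
  point of \<open>A\<close>. Strictness is essential, since \<^const>\<open>proj\<close> chooses some minimizer.
\<close>

lemma proj_eqI:
  assumes A: "A \<subseteq> carrier_vec n" and y: "y \<in> A" and x: "x \<in> carrier_vec n"
    and orth: "\<And>t. t \<in> A \<Longrightarrow> (t - y) \<bullet> (x - y) = 0"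
  shows "proj n A x = y"
proof -
  have pyth: "(vdist n x t)\<^sup>2 = (vdist n x y)\<^sup>2 + (vdist n t y)\<^sup>2" if t: "t \<in> A" for t
  proof -
    have c: "t \<in> carrier_vec n" "y \<in> carrier_vec n" using A t y by auto
    then have "x - t = (x - y) - (t - y)" using x by (intro eq_vecI) auto
    then have "(x - t) \<bullet> (x - t) = (x - y) \<bullet> (x - y) + (t - y) \<bullet> (t - y)"
      using c x orth[OF t] comm_scalar_prod[of "x - y" n "t - y"]
      by (simp add: scalar_prod_minus_distrib[of _ n] minus_scalar_prod_distrib[of _ n])
    then show ?thesis using c x by (simp add: vdist_power2)
  qed
  have min: "vdist n x y \<le> vdist n x t" if "t \<in> A" for t
    by (rule power2_le_imp_le[OF _ vdist_nonneg]) (simp add: pyth[OF that])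
  have uniq: "t = y" if t: "t \<in> A" and "vdist n x t \<le> vdist n x y" for t
  proof -
    have "(vdist n x t)\<^sup>2 \<le> (vdist n x y)\<^sup>2" using that vdist_nonneg by (intro power_mono) auto
    then have "vdist n t y = 0" using pyth[OF t] by simp
    then show ?thesis
      using A t y Metric_space.zero[OF Metric_space_vdist[of n]] by blast
  qed
  show ?thesis
    unfolding proj_def arg_min_on_def
  proof (rule arg_minI[of "\<lambda>t. t \<in> A" y "vdist n x" "\<lambda>t. t = y"])
    show "\<not> vdist n x t < vdist n x y" if "t \<in> A" for t using min[OF that] by simp
    show "t = y" if "t \<in> A" "\<forall>s. s \<in> A \<longrightarrow> \<not> vdist n x s < vdist n x t" for t
      using uniq[OF that(1)] that(2) y by (simp add: not_less)
  qed (rule y)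
qed

lemma affine_diff:
  assumes V: "lin_subspace n V" and b: "b \<in> carrier_vec n"
    and A: "A = {x \<in> carrier_vec n. x - b \<in> V}" and xy: "x \<in> A" "y \<in> A"
  shows "x - y \<in> V"
proof -
  have "x - y = (x - b) - (y - b)" using xy b by (intro eq_vecI) (auto simp: A)
  then show ?thesis using lin_subspaceD(4)[OF V] xy by (simp add: A)
qed

lemma proj_affine:
  assumes V: "lin_subspace n V" and b: "b \<in> carrier_vec n"
    and A: "A = {x \<in> carrier_vec n. x - b \<in> V}"
    and x: "x \<in> carrier_vec n"
  shows "proj n A x \<in> A" "v \<in> V \<Longrightarrow> v \<bullet> (x - proj n A x) = 0"
proof -
  note VD = lin_subspaceD[OF V]
  have diff: "x - y \<in> V" if "x \<in> A" "y \<in> A" for x y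
    by (rule affine_diff[OF V b A that])
  have one: "(1\<^sub>m n :: real Matrix.mat) \<in> carrier_mat n n" "transpose_mat (1\<^sub>m n :: real Matrix.mat) = 1\<^sub>m n"
    by auto
  have "v \<bullet> (1\<^sub>m n *\<^sub>v v) > 0" if "v \<in> V" "v \<noteq> 0\<^sub>v n" for v
    using scalar_prod_self[OF VD(1)[OF that(1)]] that VD(1)[OF that(1)] by simp
  from ex_orthogonal_projection[OF one V this, of "x - b"]
  obtain s where s: "s \<in> V" "\<And>v. v \<in> V \<Longrightarrow> v \<bullet> ((x - b) - s) = 0"
    using x b VD(1) by (auto simp: one_mult_mat_vec)
  have sc: "s \<in> carrier_vec n" using VD(1)[OF s(1)] .
  have "(b + s) - b = s" using b sc by (intro eq_vecI) auto
  then have bs: "b + s \<in> A" using s(1) sc b by (simp add: A)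
  have "x - (b + s) = (x - b) - s" using x b sc by (intro eq_vecI) auto
  then have orth: "v \<bullet> (x - (b + s)) = 0" if "v \<in> V" for v using s(2)[OF that] by simp
  have "proj n A x = b + s"
  proof (rule proj_eqI[OF _ bs x])
    show "A \<subseteq> carrier_vec n" by (auto simp: A)
    show "(t - (b + s)) \<bullet> (x - (b + s)) = 0" if "t \<in> A" for t by (rule orth[OF diff[OF that bs]])
  qed
  then show "proj n A x \<in> A" "v \<in> V \<Longrightarrow> v \<bullet> (x - proj n A x) = 0"
    using bs orth by simp_all
qed

text \<open>
  Both the optimum \<open>y\<close> and the iterates are described by orthogonality to \<open>V\<close>: \<open>M (y - c) \<bottom> V\<close> for the
  optimum and \<open>r - w (k + 1) \<bottom> V\<close> for the image of the gradient step \<open>r\<close>. Subtracting the two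
  conditions shows that the new error \<open>e\<close> satisfies \<open>e \<bullet> e = e \<bullet> u\<close>, where \<open>u\<close> is the gradient step of
  the old error for the homogeneous problem, so \<open>|e| \<le> |u|\<close>.

  The error contracts only along \<open>V\<close>. The initial point may lie outside \<open>A\<close>, so the
  geometric decay is counted from the second iterate.
\<close>

theorem projected_gradient_converges:
  fixes M :: "real Matrix.mat" and w :: "nat \<Rightarrow> real Matrix.vec"
  assumes M: "M \<in> carrier_mat n n" "transpose_mat M = M"
    and psd: "\<And>x. x \<in> carrier_vec n \<Longrightarrow> x \<bullet> (M *\<^sub>v x) \<ge> 0"
    and le: "\<And>x. x \<in> carrier_vec n \<Longrightarrow> x \<bullet> (M *\<^sub>v x) \<le> l * (x \<bullet> x)"
    and l: "l \<ge> 0" and a: "a > 0" "a * l < 1"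
    and V: "lin_subspace n V" and m: "m > 0" "\<And>v. v \<in> V \<Longrightarrow> m * (v \<bullet> v) \<le> v \<bullet> (M *\<^sub>v v)"
    and b: "b \<in> carrier_vec n"
    and A: "A = {x \<in> carrier_vec n. x - b \<in> V}"
    and c: "c \<in> carrier_vec n"
    and w1: "w 1 \<in> carrier_vec n"
    and step: "\<And>k. k \<ge> 1 \<Longrightarrow> w (k + 1) = proj n A (w k - a \<cdot>\<^sub>v (2 \<cdot>\<^sub>v (M *\<^sub>v (w k - c))))"
  shows "\<exists>y\<in>A. (\<forall>x\<in>A. (y - c) \<bullet> (M *\<^sub>v (y - c)) \<le> (x - c) \<bullet> (M *\<^sub>v (x - c))) \<and>
    (\<forall>x\<in>A. (x - c) \<bullet> (M *\<^sub>v (x - c)) \<le> (y - c) \<bullet> (M *\<^sub>v (y - c)) \<longrightarrow> x = y) \<and>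
    limitin (vtop n) w y sequentially"
proof -
  note VD = lin_subspaceD[OF V]
  have pos: "v \<bullet> (M *\<^sub>v v) > 0" if "v \<in> V" "v \<noteq> 0\<^sub>v n" for v
  proof -
    have "v \<bullet> v > 0" using scalar_prod_self[OF VD(1)[OF that(1)]] that(2) by linarith
    then show ?thesis using m(2)[OF that(1)] mult_pos_pos[OF m(1)] by fastforce
  qed
  have diff: "x - y \<in> V" if "x \<in> A" "y \<in> A" for x y
    by (rule affine_diff[OF V b A that])
  have Ac: "x \<in> carrier_vec n" if "x \<in> A" for x using that by (simp add: A)
  obtain p where p: "p \<in> V" "\<And>v. v \<in> V \<Longrightarrow> v \<bullet> (M *\<^sub>v ((c - b) - p)) = 0"
    using ex_orthogonal_projection[OF M V pos, of "c - b"] b c by auto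
  define y where "y = b + p"
  have pc: "p \<in> carrier_vec n" using VD(1)[OF p(1)] .
  have yc: "y \<in> carrier_vec n" using pc b by (simp add: y_def)
  have "y - b = p" using b pc by (intro eq_vecI) (auto simp: y_def)
  then have y: "y \<in> A" using p(1) b pc by (simp add: A y_def)
  have opt: "v \<bullet> (M *\<^sub>v (y - c)) = 0" if "v \<in> V" for v
  proof -
    have "y - c = (-1) \<cdot>\<^sub>v ((c - b) - p)"
      using b c pc by (intro eq_vecI) (auto simp: y_def)
    then show ?thesis using p(2)[OF that] VD(1)[OF that] M b c pc
      by (simp add: mult_mat_vec[OF M(1)] scalar_prod_linear[of _ n])
  qed
  \<comment> \<open>Optimality removes the mixed term, so the cost exceeds its minimum by the form of \<open>x - y\<close>.\<close>
  have val: "(x - c) \<bullet> (M *\<^sub>v (x - c)) = (y - c) \<bullet> (M *\<^sub>v (y - c)) + (x - y) \<bullet> (M *\<^sub>v (x - y))"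
    if x: "x \<in> A" for x
  proof -
    have "x - c = (y - c) + 1 \<cdot>\<^sub>v (x - y)" using Ac[OF x] yc c by (intro eq_vecI) auto
    then show ?thesis
      using quad_form_add_smult[OF M, of "y - c" "x - y" 1] opt[OF diff[OF x y]] Ac[OF x] yc c by simp
  qed
  have min: "(y - c) \<bullet> (M *\<^sub>v (y - c)) \<le> (x - c) \<bullet> (M *\<^sub>v (x - c))" if "x \<in> A" for x
    using val[OF that] psd[of "x - y"] Ac[OF that] yc by simp
  have uniq: "x = y" if x: "x \<in> A" "(x - c) \<bullet> (M *\<^sub>v (x - c)) \<le> (y - c) \<bullet> (M *\<^sub>v (y - c))" for x
  proof -
    have "x - y = 0\<^sub>v n" using val[OF x(1)] x(2) pos[OF diff[OF x(1) y]] by linarith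
    then show ?thesis by (rule eq_if_minus_eq_zero_vec[OF Ac[OF x(1)] yc])
  qed
  note proj_orth = proj_affine[OF V b A]
  have wc: "w k \<in> carrier_vec n" if "k \<ge> 1" for k
    using that
  proof (induction k rule: nat_induct_at_least)
    case base
    show ?case by (rule w1)
  next
    case (Suc k)
    have "w k - a \<cdot>\<^sub>v (2 \<cdot>\<^sub>v (M *\<^sub>v (w k - c))) \<in> carrier_vec n" using Suc.IH M c by simp
    then show ?case using step[OF Suc.hyps] proj_orth Ac by simp
  qed
  have wA: "w (Suc k) \<in> A" if "k \<ge> 1" for k
  proof -
    have "w k - a \<cdot>\<^sub>v (2 \<cdot>\<^sub>v (M *\<^sub>v (w k - c))) \<in> carrier_vec n" using wc[OF that] M c by simp
    then show ?thesis using step[OF that] proj_orth by simp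
  qed
  \<comment> \<open>The maximum with \<open>0\<close> keeps \<open>\<kappa>\<close> nonnegative even if \<open>V\<close> is trivial and \<open>m\<close> is arbitrarily large.\<close>
  define \<kappa> where "\<kappa> = max 0 (1 - 4 * a * (1 - a * l) * m)"
  have \<kappa>: "0 \<le> \<kappa>" "\<kappa> < 1" using a m by (auto simp: \<kappa>_def)
  have contract: "(vdist n (w (Suc k)) y)\<^sup>2 \<le> \<kappa> * (vdist n (w k) y)\<^sup>2" if k: "k \<ge> 2" for k
  proof -
    have x: "w k \<in> A" using wA[of "k - 1"] k by simp
    define d where "d = w k - y"
    define e where "e = w (Suc k) - y"
    define u where "u = d - a \<cdot>\<^sub>v (2 \<cdot>\<^sub>v (M *\<^sub>v d))"
    define r where "r = w k - a \<cdot>\<^sub>v (2 \<cdot>\<^sub>v (M *\<^sub>v (w k - c)))"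
    have carr: "w k \<in> carrier_vec n" "w (Suc k) \<in> carrier_vec n"
      using wc[of k] wc[of "Suc k"] k by auto
    have d: "d \<in> V" "d \<in> carrier_vec n" using diff[OF x y] VD(1) by (auto simp: d_def)
    have e: "e \<in> V" "e \<in> carrier_vec n"
      using diff[OF wA[of k] y] k VD(1) by (auto simp: e_def)
    have uc: "u \<in> carrier_vec n" and rc: "r \<in> carrier_vec n"
      using d M carr c by (auto simp: u_def r_def)
    have "e \<bullet> (r - w (Suc k)) = 0"
      using proj_orth[OF rc] step[of k] k e(1) by (simp add: r_def)
    moreover have "M *\<^sub>v (w k - c) = M *\<^sub>v d + M *\<^sub>v (y - c)"
    proof -
      have "w k - c = d + (y - c)" using carr yc c by (intro eq_vecI) (auto simp: d_def)
      then show ?thesis using d yc c by (simp add: mult_mat_vec_linear[OF M(1)])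
    qed
    then have "r - w (Suc k) = u - (2 * a) \<cdot>\<^sub>v (M *\<^sub>v (y - c)) - e"
      unfolding r_def u_def e_def using carr yc c M d
      by (intro eq_vecI) (auto simp: d_def algebra_simps)
    ultimately have "e \<bullet> e = e \<bullet> u"
      using opt[OF e(1)] e(2) uc M yc c
      by (simp add: scalar_prod_minus_distrib[of _ n] scalar_prod_smult_distrib[of _ n])
    then have "(e \<bullet> e) * (e \<bullet> e) \<le> (e \<bullet> e) * (u \<bullet> u)"
      using cauchy_schwarz_vec[OF e(2) uc] by (simp add: power2_eq_square)
    then have "e \<bullet> e \<le> u \<bullet> u"
      using scalar_prod_self(2)[OF e(2)] scalar_prod_self(2)[OF uc]
      by (cases "e \<bullet> e = 0") (auto simp: mult_le_cancel_left)
    also have "\<dots> \<le> (1 - 4 * a * (1 - a * l) * m) * (d \<bullet> d)"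
      unfolding u_def by (rule gradient_step_contracts[OF M psd le l a d(2) m(2)[OF d(1)]])
    also have "\<dots> \<le> \<kappa> * (d \<bullet> d)"
      using scalar_prod_self(2)[OF d(2)] by (intro mult_right_mono) (auto simp: \<kappa>_def)
    finally show ?thesis using carr yc by (simp add: vdist_power2 d_def e_def)
  qed
  have geo: "(vdist n (w (k + 2)) y)\<^sup>2 \<le> \<kappa> ^ k * (vdist n (w 2) y)\<^sup>2" for k
  proof (induction k)
    case (Suc k)
    have "(vdist n (w (Suc k + 2)) y)\<^sup>2 \<le> \<kappa> * (vdist n (w (k + 2)) y)\<^sup>2"
      using contract[of "k + 2"] by simp
    also have "\<dots> \<le> \<kappa> * (\<kappa> ^ k * (vdist n (w 2) y)\<^sup>2)" using Suc \<kappa> by (intro mult_left_mono) auto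
    finally show ?case by (simp add: mult.assoc)
  qed (simp add: numeral_2_eq_2)
  have "(\<lambda>k. \<kappa> ^ k * (vdist n (w 2) y)\<^sup>2) \<longlonglongrightarrow> 0"
    using \<kappa> by (intro tendsto_mult_left_zero LIMSEQ_realpow_zero)
  then have "(\<lambda>k. (vdist n (w (k + 2)) y)\<^sup>2) \<longlonglongrightarrow> 0"
    by (rule tendsto_sandwich[OF _ _ tendsto_const, rotated 2]) (use geo in auto)
  then have "(\<lambda>k. sqrt ((vdist n (w (k + 2)) y)\<^sup>2)) \<longlonglongrightarrow> sqrt 0" by (rule tendsto_real_sqrt)
  then have "(\<lambda>k. vdist n (w (k + 2)) y) \<longlonglongrightarrow> 0" by (simp add: vdist_nonneg)
  then have "(\<lambda>k. vdist n (w k) y) \<longlonglongrightarrow> 0" by (rule LIMSEQ_offset)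
  moreover have "eventually (\<lambda>k. w k \<in> carrier_vec n) sequentially"
    using wc by (rule eventually_sequentiallyI)
  ultimately have "limitin (vtop n) w y sequentially"
    unfolding vtop_def Metric_space.limitin_metric_dist_null[OF Metric_space_vdist]
    using yc by simp
  then show ?thesis
    by (intro bexI[of _ y] conjI ballI impI min uniq y)
qed

section \<open>Selection matrices and block diagonal weights\<close>

lemma Pi_first_mult_vec:
  assumes "x \<in> carrier_vec (a + b)"
  shows "Pi_first a b *\<^sub>v x = vec_first x a"
proof -
  have "Pi_first a b *\<^sub>v (vec_first x a @\<^sub>v vec_last x b) =
      (1\<^sub>m a *\<^sub>v vec_first x a + 0\<^sub>m a b *\<^sub>v vec_last x b) @\<^sub>v
      (0\<^sub>m 0 a *\<^sub>v vec_first x a + 0\<^sub>m 0 b *\<^sub>v vec_last x b)"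
    unfolding Pi_first_def by (rule four_block_mat_mult_vec) auto
  then show ?thesis using assms by (auto intro!: eq_vecI)
qed

lemma Pi_last_mult_vec:
  assumes "x \<in> carrier_vec (a + b)"
  shows "Pi_last a b *\<^sub>v x = vec_last x b"
proof -
  have "Pi_last a b *\<^sub>v (vec_first x a @\<^sub>v vec_last x b) =
      (0\<^sub>m b a *\<^sub>v vec_first x a + 1\<^sub>m b *\<^sub>v vec_last x b) @\<^sub>v
      (0\<^sub>m 0 a *\<^sub>v vec_first x a + 0\<^sub>m 0 b *\<^sub>v vec_last x b)"
    unfolding Pi_last_def by (rule four_block_mat_mult_vec) auto
  then show ?thesis using assms by (auto intro!: eq_vecI)
qed

lemma Pi_first_carrier: "Pi_first a b \<in> carrier_mat a (a + b)"
  unfolding Pi_first_def carrier_mat_def by simp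

lemma Pi_last_carrier: "Pi_last a b \<in> carrier_mat b (a + b)"
  unfolding Pi_last_def carrier_mat_def by simp

text \<open>
  The transpose prepends zeros. It serves to lift the reference from the last \<open>b\<close> coordinates to the
  whole space.
\<close>

lemma Pi_last_mult_transpose:
  assumes y: "y \<in> carrier_vec b"
  shows "Pi_last a b *\<^sub>v (transpose_mat (Pi_last a b) *\<^sub>v y) = y"
proof -
  have "transpose_mat (Pi_last a b) = four_block_mat (0\<^sub>m a b) (0\<^sub>m a 0) (1\<^sub>m b) (0\<^sub>m b 0)"
    unfolding Pi_last_def by (subst transpose_four_block_mat[of _ b a _ b _ 0]) auto
  moreover have "four_block_mat (0\<^sub>m a b) (0\<^sub>m a 0) (1\<^sub>m b) (0\<^sub>m b 0) *\<^sub>v (y @\<^sub>v 0\<^sub>v 0) =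
      (0\<^sub>m a b *\<^sub>v y + 0\<^sub>m a 0 *\<^sub>v 0\<^sub>v 0) @\<^sub>v (1\<^sub>m b *\<^sub>v y + 0\<^sub>m b 0 *\<^sub>v 0\<^sub>v 0)"
    by (rule four_block_mat_mult_vec) (use y in auto)
  moreover have "y @\<^sub>v 0\<^sub>v 0 = y" by (rule eq_vecI) auto
  ultimately have T: "transpose_mat (Pi_last a b) *\<^sub>v y = 0\<^sub>v a @\<^sub>v y"
    using y by (auto intro!: eq_vecI)
  have "0\<^sub>v a @\<^sub>v y \<in> carrier_vec (a + b)" using y by simp
  then show ?thesis unfolding T Pi_last_mult_vec
    using y by (auto simp: vec_last_def Pi_last_mult_vec intro!: eq_vecI)
qed

definition vec_block :: "nat \<Rightarrow> nat \<Rightarrow> real Matrix.vec \<Rightarrow> real Matrix.vec" where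
  "vec_block q t y = Matrix.vec q (\<lambda>j. y $ (t * q + j))"

lemma vec_block_carrier[simp]: "vec_block q t y \<in> carrier_vec q"
  by (simp add: vec_block_def)

lemma sum_blocks:
  fixes f :: "nat \<Rightarrow> real"
  shows "(\<Sum>i<T * q. f i) = (\<Sum>t<T. \<Sum>j<q. f (t * q + j))"
proof -
  have "(\<Sum>i = t * q..<t * q + q. f i) = (\<Sum>j<q. f (t * q + j))" for t
    using sum.shift_bounds_nat_ivl[of f 0 "t * q" q]
    by (simp add: atLeast0LessThan add.commute)
  then show ?thesis by (simp add: sum.nat_group[symmetric])
qed

lemma scalar_prod_blocks:
  assumes "y \<in> carrier_vec (q * T)"
  shows "x \<bullet> y = (\<Sum>t<T. vec_block q t x \<bullet> vec_block q t y)"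
  using assms
  by (simp add: scalar_prod_def vec_block_def atLeast0LessThan mult.commute[of q] sum_blocks)

lemma kron_one_carrier:
  assumes "\<Phi> \<in> carrier_mat q q"
  shows "kron (1\<^sub>m T) \<Phi> \<in> carrier_mat (q * T) (q * T)"
  using assms by (simp add: kron_def mult.commute)

lemma transpose_kron_one:
  assumes P: "\<Phi> \<in> carrier_mat q q" "transpose_mat \<Phi> = \<Phi>"
  shows "transpose_mat (kron (1\<^sub>m T) \<Phi>) = kron (1\<^sub>m T) \<Phi>"
proof (rule eq_matI)
  fix i j assume "i < dim_row (kron (1\<^sub>m T) \<Phi>)" "j < dim_col (kron (1\<^sub>m T) \<Phi>)"
  then have ij: "i < T * q" "j < T * q" using P by (auto simp: kron_def)
  then have "q > 0" by (cases q) auto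
  with ij have "i div q < T" "j div q < T" "i mod q < q" "j mod q < q"
    by (auto simp: less_mult_imp_div_less)
  moreover have "\<Phi> $$ (j mod q, i mod q) = \<Phi> $$ (i mod q, j mod q)"
    using arg_cong[OF P(2), of "\<lambda>A. A $$ (i mod q, j mod q)"] P(1) \<open>q > 0\<close> by simp
  ultimately show "transpose_mat (kron (1\<^sub>m T) \<Phi>) $$ (i, j) = kron (1\<^sub>m T) \<Phi> $$ (i, j)"
    using P ij by (auto simp: kron_def)
qed (use P in \<open>auto simp: kron_def\<close>)

lemma vec_block_kron_one:
  assumes P: "\<Phi> \<in> carrier_mat q q" and y: "y \<in> carrier_vec (q * T)" and t: "t < T"
  shows "vec_block q t (kron (1\<^sub>m T) \<Phi> *\<^sub>v y) = \<Phi> *\<^sub>v vec_block q t y"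
proof (rule eq_vecI)
  fix j assume "j < dim_vec (\<Phi> *\<^sub>v vec_block q t y)"
  then have j: "j < q" using P by simp
  have lt: "s * q + k < T * q" if "s < T" "k < q" for s k
  proof -
    have "s * q + k < Suc s * q" using that by simp
    also have "\<dots> \<le> T * q" using that by (intro mult_right_mono) auto
    finally show ?thesis .
  qed
  have "(kron (1\<^sub>m T) \<Phi> *\<^sub>v y) $ (t * q + j)
      = (\<Sum>i<T * q. kron (1\<^sub>m T) \<Phi> $$ (t * q + j, i) * y $ i)"
    using lt[OF t j] P y kron_one_carrier[OF P, of T]
    by (simp add: scalar_prod_def atLeast0LessThan mult.commute[of q])
  also have "\<dots> = (\<Sum>s<T. \<Sum>k<q. (if s = t then \<Phi> $$ (j, k) * y $ (s * q + k) else 0))"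
    unfolding sum_blocks
    using lt t j P by (intro sum.cong) (auto simp: kron_def)
  also have "\<dots> = (\<Sum>s<T. if s = t then \<Sum>k<q. \<Phi> $$ (j, k) * y $ (s * q + k) else 0)"
    by (intro sum.cong) auto
  also have "\<dots> = (\<Sum>k<q. \<Phi> $$ (j, k) * y $ (t * q + k))" using t by simp
  also have "\<dots> = (\<Phi> *\<^sub>v vec_block q t y) $ j"
    using j P by (simp add: scalar_prod_def vec_block_def atLeast0LessThan)
  finally show "vec_block q t (kron (1\<^sub>m T) \<Phi> *\<^sub>v y) $ j = (\<Phi> *\<^sub>v vec_block q t y) $ j"
    using j by (simp add: vec_block_def)
qed (use P in \<open>simp add: vec_block_def\<close>)

text \<open>
  Thus every two-sided bound of the form of \<open>\<Phi>\<close> by multiples of the squared norm carries over to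
  \<open>I \<otimes> \<Phi>\<close> with the same constants.
\<close>

lemma kron_one_quad_form:
  assumes "\<Phi> \<in> carrier_mat q q" "y \<in> carrier_vec (q * T)"
  shows "y \<bullet> (kron (1\<^sub>m T) \<Phi> *\<^sub>v y) = (\<Sum>t<T. vec_block q t y \<bullet> (\<Phi> *\<^sub>v vec_block q t y))"
proof -
  have "kron (1\<^sub>m T) \<Phi> *\<^sub>v y \<in> carrier_vec (q * T)"
    by (rule mult_mat_vec_carrier[OF kron_one_carrier[OF assms(1)] assms(2)])
  then show ?thesis
    by (simp add: scalar_prod_blocks vec_block_kron_one[OF assms])
qed

section \<open>Restricted behaviors and convergence of the iteration\<close>

lemma lin_subspace_restr_behavior:
  assumes B: "linear_behavior q B" and q: "q \<ge> 1"
  shows "lin_subspace (q * T) (restr_behavior q T B)"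
  unfolding lin_subspace_def restr_behavior_def
proof (intro conjI ballI allI)
  show "col_traj q T ` B \<subseteq> carrier_vec (q * T)" by (auto simp: col_traj_def)
  have "col_traj q T (\<lambda>t\<in>{1..}. 0\<^sub>v q) = 0\<^sub>v (q * T)"
    using q by (intro eq_vecI) (auto simp: col_traj_def)
  moreover have "(\<lambda>t\<in>{1..}. 0\<^sub>v q) \<in> B" using B by (simp add: linear_behavior_def)
  ultimately show "0\<^sub>v (q * T) \<in> col_traj q T ` B" by (metis imageI)
  fix x y and c :: real assume "x \<in> col_traj q T ` B" "y \<in> col_traj q T ` B"
  then obtain u v where uv: "u \<in> B" "v \<in> B" "x = col_traj q T u" "y = col_traj q T v" by auto
  have carr: "u t \<in> carrier_vec q" "v t \<in> carrier_vec q" if "t \<ge> 1" for t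
    using B uv(1,2) that by (auto simp: linear_behavior_def seqs_def PiE_def Pi_def)
  define cv where "cv = (\<lambda>t\<in>{1..}. c \<cdot>\<^sub>v v t)"
  define s where "s = (\<lambda>t\<in>{1..}. u t + cv t)"
  have "cv \<in> B" using B uv by (simp add: linear_behavior_def cv_def)
  then have "s \<in> B" using B uv by (simp add: linear_behavior_def s_def)
  moreover have "x + c \<cdot>\<^sub>v y = col_traj q T s"
  proof (rule eq_vecI)
    fix i assume "i < dim_vec (col_traj q T s)"
    then have i: "i < q * T" by (simp add: col_traj_def)
    have "i mod q < q" using q by simp
    then show "(x + c \<cdot>\<^sub>v y) $ i = col_traj q T s $ i"
      using carr[of "i div q + 1"] i
      by (simp add: uv col_traj_def s_def cv_def)
  qed (simp add: uv col_traj_def)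
  ultimately show "x + c \<cdot>\<^sub>v y \<in> col_traj q T ` B" by blast
qed

lemma vec_first_col_traj:
  "vec_first (col_traj q (S + T) w) (q * S) = col_traj q S w"
  by (rule eq_vecI) (auto simp: vec_first_def col_traj_def distrib_left)

theorem theorem1:
  fixes q Tini Tf :: nat
    and B :: "seq set"
    and w_ref w_ini :: "real Matrix.vec"
    and \<Phi> :: "real Matrix.mat"
    and \<alpha> :: real
    and w z :: "nat \<Rightarrow> real Matrix.vec"
  defines "n \<equiv> q * (Tini + Tf)"
    and "Pini \<equiv> Pi_first (q * Tini) (q * Tf)"
    and "Pf \<equiv> Pi_last (q * Tini) (q * Tf)"
    and "W \<equiv> kron (1\<^sub>m Tf) \<Phi>"
  defines "g \<equiv> (\<lambda>x. indicator_fun (restr_behavior q (Tini + Tf) B) x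
                   + indicator_fun {w_ini} (Pini *\<^sub>v x))"
    and "h \<equiv> (\<lambda>x. (Pf *\<^sub>v x - w_ref) \<bullet> (W *\<^sub>v (Pf *\<^sub>v x - w_ref)))"
    and "A \<equiv> {x \<in> restr_behavior q (Tini + Tf) B. Pini *\<^sub>v x = w_ini}"
  assumes "q \<ge> 1" and "Tini \<ge> 1" and "Tf \<ge> 1"
    and "complete_lti q B"
    and "w_ref \<in> carrier_vec (q * Tf)"
    and "sym_pos_def q \<Phi>"
    and "w_ini \<in> restr_behavior q Tini B"
    and "Tini \<ge> lag q B"
    and "\<alpha> \<in> {0<..<1 / spectral_radius (map_mat complex_of_real \<Phi>)}"
    and "w 1 \<in> carrier_vec n"
    and "\<And>k. k \<ge> 1 \<Longrightarrow> z (k + 1) = 2 \<cdot>\<^sub>v (transpose_mat Pf *\<^sub>v (W *\<^sub>v (Pf *\<^sub>v w k - w_ref)))"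
    and "\<And>k. k \<ge> 1 \<Longrightarrow> w (k + 1) = proj n A (w k - \<alpha> \<cdot>\<^sub>v z (k + 1))"
  shows "\<exists>w_opt. is_arg_min (\<lambda>x. g x + ereal (h x)) (\<lambda>x. x \<in> carrier_vec n) w_opt
           \<and> (\<forall>x. is_arg_min (\<lambda>x. g x + ereal (h x)) (\<lambda>x. x \<in> carrier_vec n) x \<longrightarrow> x = w_opt)
           \<and> limitin (vtop n) w w_opt sequentially"
proof -
  define a b where "a = q * Tini" and "b = q * Tf"
  have n: "n = a + b" by (simp add: n_def a_def b_def distrib_left)
  have q: "q \<ge> 1" by fact
  note z = \<open>\<And>k. k \<ge> 1 \<Longrightarrow> z (k + 1) = _\<close> and step = \<open>\<And>k. k \<ge> 1 \<Longrightarrow> w (k + 1) = _\<close>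
  have \<Phi>: "\<Phi> \<in> carrier_mat q q" "transpose_mat \<Phi> = \<Phi>"
    and \<Phi>pos: "\<And>x. x \<in> carrier_vec q \<Longrightarrow> x \<noteq> 0\<^sub>v q \<Longrightarrow> x \<bullet> (\<Phi> *\<^sub>v x) > 0"
    using \<open>sym_pos_def q \<Phi>\<close> by (auto simp: sym_pos_def_def)
  have wref: "w_ref \<in> carrier_vec b" using \<open>w_ref \<in> carrier_vec (q * Tf)\<close> by (simp add: b_def)
  define l where "l = spectral_radius (map_mat complex_of_real \<Phi>)"
  obtain m where m: "m > 0" "\<And>x. x \<in> carrier_vec q \<Longrightarrow> m * (x \<bullet> x) \<le> x \<bullet> (\<Phi> *\<^sub>v x)"
    using pos_def_quad_form_lower_bound[OF \<Phi>(1) q \<Phi>pos] by blast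
  have \<alpha>: "\<alpha> > 0" "\<alpha> < 1 / l" using \<open>\<alpha> \<in> _\<close> by (auto simp: l_def)
  then have "1 / l > 0" by linarith
  then have l0: "l > 0" by simp
  have \<alpha>l: "\<alpha> * l < 1" using \<alpha> l0 by (simp add: field_simps)

  have W: "W \<in> carrier_mat b b" "transpose_mat W = W"
    unfolding W_def b_def by (rule kron_one_carrier[OF \<Phi>(1)], rule transpose_kron_one[OF \<Phi>])
  have Wq: "y \<bullet> (W *\<^sub>v y) = (\<Sum>t<Tf. vec_block q t y \<bullet> (\<Phi> *\<^sub>v vec_block q t y))"
    "y \<bullet> y = (\<Sum>t<Tf. vec_block q t y \<bullet> vec_block q t y)" if "y \<in> carrier_vec b" for y
    using that unfolding W_def b_def
    by (rule kron_one_quad_form[OF \<Phi>(1)], rule scalar_prod_blocks)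
  have Wlow: "m * (y \<bullet> y) \<le> y \<bullet> (W *\<^sub>v y)" if "y \<in> carrier_vec b" for y
    unfolding Wq[OF that] sum_distrib_left by (intro sum_mono m(2)) simp
  have Wup: "y \<bullet> (W *\<^sub>v y) \<le> l * (y \<bullet> y)" if "y \<in> carrier_vec b" for y
    unfolding Wq[OF that] sum_distrib_left l_def
    by (intro sum_mono quad_form_le_spectral_radius[OF \<Phi> q]) simp

  have Pf: "Pf \<in> carrier_mat b n" and Pini: "Pini \<in> carrier_mat a n"
    unfolding Pf_def Pini_def n a_def b_def by (rule Pi_last_carrier, rule Pi_first_carrier)
  have PfT: "transpose_mat Pf \<in> carrier_mat n b" using Pf by simp
  \<comment> \<open>\<open>2 M\<close> is the Hessian of \<open>h\<close>.\<close>
  define M where "M = transpose_mat Pf * (W * Pf)"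
  have M: "M \<in> carrier_mat n n" using Pf W by (simp add: M_def)
  have Mv: "M *\<^sub>v x = transpose_mat Pf *\<^sub>v (W *\<^sub>v (Pf *\<^sub>v x))" if "x \<in> carrier_vec n" for x
    using that Pf W by (simp add: M_def assoc_mult_mat_vec[of _ n b _ n] assoc_mult_mat_vec[of _ b b _ n])
  have MT: "transpose_mat M = M"
    unfolding M_def using Pf W
    by (simp add: transpose_mult[of _ n b _ n] transpose_mult[of _ b b _ n] assoc_mult_mat[of _ n b _ b _ n])
  have Mq: "x \<bullet> (M *\<^sub>v x) = (Pf *\<^sub>v x) \<bullet> (W *\<^sub>v (Pf *\<^sub>v x))" if "x \<in> carrier_vec n" for x
  proof -
    have "W *\<^sub>v (Pf *\<^sub>v x) \<in> carrier_vec b" using Pf W that by simp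
    then show ?thesis
      using transpose_vec_mult_scalar[OF Pf that, of "W *\<^sub>v (Pf *\<^sub>v x)"] Pf W M that
        comm_scalar_prod[of x n "M *\<^sub>v x"] comm_scalar_prod[of "Pf *\<^sub>v x" b "W *\<^sub>v (Pf *\<^sub>v x)"]
      by (simp add: Mv[OF that])
  qed
  have normsplit: "x \<bullet> x = (Pini *\<^sub>v x) \<bullet> (Pini *\<^sub>v x) + (Pf *\<^sub>v x) \<bullet> (Pf *\<^sub>v x)"
    if "x \<in> carrier_vec n" for x
  proof -
    have x: "x \<in> carrier_vec (a + b)" using that by (simp add: n)
    have P: "Pini *\<^sub>v x = vec_first x a" "Pf *\<^sub>v x = vec_last x b"
      using Pi_first_mult_vec[OF x] Pi_last_mult_vec[OF x] by (simp_all add: Pini_def Pf_def a_def b_def)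
    have "(vec_first x a @\<^sub>v vec_last x b) \<bullet> (vec_first x a @\<^sub>v vec_last x b)
      = vec_first x a \<bullet> vec_first x a + vec_last x b \<bullet> vec_last x b"
      by (rule scalar_prod_append[of _ a _ b]) auto
    then show ?thesis using x by (simp add: P)
  qed
  have Mup: "x \<bullet> (M *\<^sub>v x) \<le> l * (x \<bullet> x)" if "x \<in> carrier_vec n" for x
  proof -
    have P: "Pf *\<^sub>v x \<in> carrier_vec b" "Pini *\<^sub>v x \<in> carrier_vec a" using Pf Pini that by auto
    have "x \<bullet> (M *\<^sub>v x) \<le> l * ((Pf *\<^sub>v x) \<bullet> (Pf *\<^sub>v x))"
      unfolding Mq[OF that] by (rule Wup[OF P(1)])
    also have "\<dots> \<le> l * (x \<bullet> x)"
      using normsplit[OF that] scalar_prod_self(2)[OF P(2)] l0 by (intro mult_left_mono) auto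
    finally show ?thesis .
  qed
  have Mpsd: "x \<bullet> (M *\<^sub>v x) \<ge> 0" if "x \<in> carrier_vec n" for x
  proof -
    have P: "Pf *\<^sub>v x \<in> carrier_vec b" using Pf that by auto
    have "0 \<le> m * ((Pf *\<^sub>v x) \<bullet> (Pf *\<^sub>v x))" using m scalar_prod_self(2)[OF P] by simp
    then show ?thesis using Wlow[OF P] Mq[OF that] by simp
  qed

  define R where "R = restr_behavior q (Tini + Tf) B"
  have R: "lin_subspace n R"
    unfolding R_def n_def using \<open>complete_lti q B\<close> q
    by (intro lin_subspace_restr_behavior) (auto simp: complete_lti_def)
  note RD = lin_subspaceD[OF R]
  define V where "V = {v \<in> R. Pini *\<^sub>v v = 0\<^sub>v a}"
  have V: "lin_subspace n V"
    unfolding lin_subspace_def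
  proof (intro conjI ballI allI)
    show "V \<subseteq> carrier_vec n" using RD(1) by (auto simp: V_def)
    have "Pini *\<^sub>v 0\<^sub>v n = 0\<^sub>v a" using Pini by (intro eq_vecI) auto
    then show "0\<^sub>v n \<in> V" using RD(2) by (simp add: V_def)
    fix u v and c :: real assume uv: "u \<in> V" "v \<in> V"
    then have uR: "u \<in> R" "v \<in> R" by (auto simp: V_def)
    then have uc: "u \<in> carrier_vec n" "v \<in> carrier_vec n" by (auto intro: RD(1))
    have "c \<cdot>\<^sub>v 0\<^sub>v a = 0\<^sub>v a" by (rule eq_vecI) auto
    then have "Pini *\<^sub>v (u + c \<cdot>\<^sub>v v) = 0\<^sub>v a"
      using uv uc by (simp add: V_def mult_mat_vec_linear[OF Pini])
    then show "u + c \<cdot>\<^sub>v v \<in> V" using RD(3)[OF uR] by (simp add: V_def)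
  qed
  \<comment> \<open>Vectors of \<open>V\<close> have zero past, so their norm is the norm of their last entries.\<close>
  have Mlow: "m * (v \<bullet> v) \<le> v \<bullet> (M *\<^sub>v v)" if "v \<in> V" for v
  proof -
    have v: "v \<in> carrier_vec n" using that RD(1) by (simp add: V_def)
    then have "Pf *\<^sub>v v \<in> carrier_vec b" using Pf by simp
    from Wlow[OF this] show ?thesis
      using that normsplit[OF v] by (simp add: V_def Mq[OF v])
  qed

  obtain f where f: "f \<in> B" "w_ini = col_traj q Tini f"
    using \<open>w_ini \<in> restr_behavior q Tini B\<close> by (auto simp: restr_behavior_def)
  \<comment> \<open>A trajectory whose restriction is \<open>w_ini\<close> is itself a feasible continuation.\<close>
  define x0 where "x0 = col_traj q (Tini + Tf) f"
  have x0R: "x0 \<in> R" using f by (simp add: x0_def R_def restr_behavior_def)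
  have x0: "x0 \<in> carrier_vec n" by (rule RD(1)[OF x0R])
  have Px0: "Pini *\<^sub>v x0 = w_ini"
    using x0 Pi_first_mult_vec[of x0 a b] vec_first_col_traj[of q Tini Tf f]
    by (simp add: n f(2) Pini_def a_def b_def x0_def)
  have wini: "w_ini \<in> carrier_vec a" by (simp add: f(2) col_traj_def a_def)
  have A: "A = {x \<in> carrier_vec n. x - x0 \<in> V}"
  proof (intro Set.set_eqI iffI)
    fix x assume "x \<in> A"
    then have x: "x \<in> R" "Pini *\<^sub>v x = w_ini" by (auto simp: A_def R_def)
    have xc: "x \<in> carrier_vec n" by (rule RD(1)[OF x(1)])
    have "Pini *\<^sub>v (x - x0) = 0\<^sub>v a"
      using x(2) Px0 wini by (simp add: mult_mat_vec_linear[OF Pini xc x0])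
    then show "x \<in> {x \<in> carrier_vec n. x - x0 \<in> V}"
      using RD(4)[OF x(1) x0R] xc by (simp add: V_def)
  next
    fix x assume "x \<in> {x \<in> carrier_vec n. x - x0 \<in> V}"
    then have xc: "x \<in> carrier_vec n" and d: "x - x0 \<in> R" "Pini *\<^sub>v (x - x0) = 0\<^sub>v a"
      by (auto simp: V_def)
    have "x = (x - x0) + 1 \<cdot>\<^sub>v x0" using xc x0 by (intro eq_vecI) auto
    then have "x \<in> R" using RD(3)[OF d(1) x0R, of 1] by simp
    moreover have "Pini *\<^sub>v x = w_ini"
    proof (rule eq_if_minus_eq_zero_vec[OF _ wini])
      show "Pini *\<^sub>v x \<in> carrier_vec a" using Pini xc by simp
      show "Pini *\<^sub>v x - w_ini = 0\<^sub>v a"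
        using d(2) Px0 by (simp add: mult_mat_vec_linear[OF Pini xc x0])
    qed
    ultimately show "x \<in> A" by (simp add: A_def R_def)
  qed

  define c where "c = transpose_mat Pf *\<^sub>v w_ref"
  have c: "c \<in> carrier_vec n" using PfT wref by (simp add: c_def)
  have Pfc: "Pf *\<^sub>v c = w_ref"
    unfolding c_def Pf_def a_def[symmetric] b_def[symmetric] by (rule Pi_last_mult_transpose[OF wref])
  have shift_ref: "Pf *\<^sub>v x - w_ref = Pf *\<^sub>v (x - c)" if "x \<in> carrier_vec n" for x
    by (simp add: mult_mat_vec_linear[OF Pf that c] Pfc)
  have h: "h x = (x - c) \<bullet> (M *\<^sub>v (x - c))" if "x \<in> carrier_vec n" for x
    using that c by (simp add: h_def shift_ref Mq)
  have wc: "w k \<in> carrier_vec n" if "k \<ge> 1" for k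
    using that
  proof (induction k rule: nat_induct_at_least)
    case base
    show ?case by fact
  next
    case (Suc k)
    have "w k - \<alpha> \<cdot>\<^sub>v z (k + 1) \<in> carrier_vec n"
      unfolding z[OF Suc.hyps] using Suc.IH Pf PfT W wref by simp
    from proj_affine(1)[OF V x0 A this] show ?case
      using step[OF Suc.hyps] by (simp add: A)
  qed
  have "w (k + 1) = proj n A (w k - \<alpha> \<cdot>\<^sub>v (2 \<cdot>\<^sub>v (M *\<^sub>v (w k - c))))" if "k \<ge> 1" for k
    unfolding step[OF that] z[OF that] using wc[OF that] c by (simp add: shift_ref Mv)
  from projected_gradient_converges[OF M MT Mpsd Mup less_imp_le[OF l0] \<alpha>(1) \<alpha>l V m(1) Mlow x0 A c
      \<open>w 1 \<in> carrier_vec n\<close> this]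
  obtain y where y: "y \<in> A"
    and "\<forall>x\<in>A. (y - c) \<bullet> (M *\<^sub>v (y - c)) \<le> (x - c) \<bullet> (M *\<^sub>v (x - c))"
    and "\<forall>x\<in>A. (x - c) \<bullet> (M *\<^sub>v (x - c)) \<le> (y - c) \<bullet> (M *\<^sub>v (y - c)) \<longrightarrow> x = y"
    and lim: "limitin (vtop n) w y sequentially"
    by blast
  then have min: "h y \<le> h x" and uniq: "h x \<le> h y \<Longrightarrow> x = y" if "x \<in> A" for x
    using that by (auto simp: A h)
  have yc: "y \<in> carrier_vec n" using y by (simp add: A)
  have obj: "g x + ereal (h x) = (if x \<in> A then ereal (h x) else \<infinity>)" for x
    by (simp add: g_def A_def indicator_fun_def)
  have "is_arg_min (\<lambda>x. g x + ereal (h x)) (\<lambda>x. x \<in> carrier_vec n) y"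
    unfolding is_arg_min_def obj using y yc min by (auto simp: not_less)
  moreover have "x = y" if "is_arg_min (\<lambda>x. g x + ereal (h x)) (\<lambda>x. x \<in> carrier_vec n) x" for x
  proof -
    have le: "\<not> (if y \<in> A then ereal (h y) else \<infinity>) < (if x \<in> A then ereal (h x) else \<infinity>)"
      using that yc unfolding is_arg_min_def obj by blast
    then have "x \<in> A" using y by (auto split: if_splits)
    then show ?thesis using le y uniq by (simp add: not_less)
  qed
  ultimately show ?thesis using lim by blast
qed

end
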